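(* Let $n\ge 3$, let $W_n$ be the wheel graph with central vertex $v_0$ and outer vertices $v_1,\dots,v_n$, and let $(\mathbf d,\mathbf r)$ be an arithmetical structure on $W_n$, where $\mathbf d=(d_0,d_1,\dots,d_n)$ and $\mathbf r=(r_0,r_1,\dots,r_n)$. If $\mathbf r\neq(1,1,\dots,1)$, then one of the following holds: (1) $d_0>n$ and $d_i<3$ for some $i\in\{1,\dots,n\}$; (2) $d_0<n$ and $d_i>3$ for some $i\in\{1,\dots,n\}$; (3) $d_0=n$ and there are $i\neq j$ in $\{1,\dots,n\}$ with $d_i<3$ and $d_j>3$. Moreover, if $d_i=1$ for some $i\in\{0,1,\dots,n\}$, then $d_j>1$ for every $j$ such that $v_j$ is adjacent to $v_i$ in $W_n$.
   Context: $\mathbb N$ denotes the positive integers. For a finite connected simple graph $G$ with vertex set $V$ and adjacency matrix $A$, an arithmetical structure on $G$ is a pair $(\mathbf d,\mathbf r)\in\mathbb N^V\times\mathbb N^V$ such that the gcd of the entries of $\mathbf r$ is $1$ and $(\operatorname{diag}(\mathbf d)-A)\mathbf r=0$, i.e. $d_vr_v=\sum_{u\sim v}r_u$ for every vertex $v$. The wheel graph $W_n$ ($n\ge 3$) has $n+1$ vertices $v_0,v_1,\dots,v_n$: the vertices $v_1,\dots,v_n$ form a cycle in this cyclic order ($v_i$ adjacent to $v_{i+1}$ for $1\le i<n$, and $v_n$ adjacent to $v_1$), and the central vertex $v_0$ is adjacent to all of $v_1,\dots,v_n$. Entries are indexed so that $d_i,r_i$ belong to $v_i$. *)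

theory Defs
  imports "Graph_Theory.Graph_Theory"
begin

text \<open>A simple graph is a \<^term>\<open>pair_graph\<close>: finite, loop-free, with a symmetric set
  of arcs, so that \<open>(u, v) \<in> parcs G\<close> expresses that \<open>u\<close> and \<open>v\<close> are adjacent.
  The last conjunct is the row of \<open>(diag d - A) r = 0\<close> at \<open>v\<close>, written without
  subtraction. The notion is meant for finite connected simple graphs. Values of \<open>d\<close> and
  \<open>r\<close> outside \<open>pverts G\<close> are irrelevant.\<close>

definition arithmetical_structure ::
    "'a pair_pre_digraph \<Rightarrow> ('a \<Rightarrow> nat) \<Rightarrow> ('a \<Rightarrow> nat) \<Rightarrow> bool" where
  "arithmetical_structure G d r \<longleftrightarrow>
     (\<forall>v \<in> pverts G. d v > 0 \<and> r v > 0) \<and>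
     Gcd (r ` pverts G) = 1 \<and>
     (\<forall>v \<in> pverts G. d v * r v = (\<Sum>u | (v, u) \<in> parcs G. r u))"

definition wheel_edges :: "nat \<Rightarrow> (nat \<times> nat) set" where
  "wheel_edges n = {(i, i + 1) | i. 1 \<le> i \<and> i < n} \<union> {(n, 1)} \<union> {(0, i) | i. 1 \<le> i \<and> i \<le> n}"

definition wheel :: "nat \<Rightarrow> nat pair_pre_digraph" where
  "wheel n = \<lparr> pverts = {0..n}, parcs = wheel_edges n \<union> (wheel_edges n)\<inverse> \<rparr>"

lemma pverts_wheel [simp]: "pverts (wheel n) = {0..n}"
  by (simp add: wheel_def)

lemma pair_graph_wheel:
  assumes "n \<ge> 3"
  shows "pair_graph (wheel n)"
proof -
  have sub: "parcs (wheel n) \<subseteq> {0..n} \<times> {0..n}"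
    using assms by (auto simp: wheel_def wheel_edges_def)
  then have fin: "finite (parcs (wheel n))"
    by (rule finite_subset) simp
  have sym: "sym (parcs (wheel n))"
    by (auto simp: wheel_def sym_def)
  show ?thesis
  proof
    fix e assume e: "e \<in> parcs (wheel n)"
    then show "fst e \<in> pverts (wheel n)" and "snd e \<in> pverts (wheel n)"
      using sub by auto
    show "fst e \<noteq> snd e"
      using e assms by (auto simp: wheel_def wheel_edges_def)
  qed (use fin sym in \<open>simp_all add: symmetric_def\<close>)
qed

lemma connected_wheel:
  assumes "n \<ge> 3"
  shows "connected (with_proj (wheel n))"
proof -
  interpret pair_graph "wheel n"
    using assms by (rule pair_graph_wheel)
  have "u \<rightarrow>\<^sup>*\<^bsub>with_proj (wheel n)\<^esub> 0" "0 \<rightarrow>\<^sup>*\<^bsub>with_proj (wheel n)\<^esub> u" if "u \<in> {0..n}" for u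
  proof -
    have "u = 0 \<or> (u, 0) \<in> parcs (wheel n) \<and> (0, u) \<in> parcs (wheel n)"
      using that by (auto simp: wheel_def wheel_edges_def)
    then show "u \<rightarrow>\<^sup>*\<^bsub>with_proj (wheel n)\<^esub> 0" "0 \<rightarrow>\<^sup>*\<^bsub>with_proj (wheel n)\<^esub> u"
      by (auto intro: reachable_adjI)
  qed
  then have reach: "u \<rightarrow>\<^sup>*\<^bsub>with_proj (wheel n)\<^esub> v" if "u \<in> {0..n}" "v \<in> {0..n}" for u v
    using that reachable_trans by blast
  show ?thesis
    unfolding connected_def strongly_connected_def
    using reach by (auto intro: reachable_mk_symmetricI)
qed

end

theory Submission
  imports Defs
begin

text \<open>
  Summing the equations \<open>d v * r v = (\<Sum>u\<sim>v. r u)\<close> over all vertices counts each \<open>r u\<close>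
  once per neighbour of \<open>u\<close>, so \<open>\<Sum>v. (d v - deg v) * r v = 0\<close> on every finite simple
  graph (lemma \<open>degree_excess_balance\<close>). In a wheel the hub has degree \<open>n\<close> and every rim
  vertex has degree \<open>3\<close>. Since \<open>r\<close> is positive, a positive excess \<open>d 0 - n\<close> at the hub
  must be compensated by a negative excess \<open>d i - 3\<close> on the rim, and conversely.

  If the excess at the hub vanishes, the excesses on the rim either take both signs or all
  vanish. In the latter case \<open>d\<close> is the degree vector, so every entry of \<open>r\<close> is the average
  of its neighbours; the maximum principle on a connected graph makes \<open>r\<close> constant, and the
  gcd condition makes the constant \<open>1\<close> (lemma \<open>structure_of_degrees_trivial\<close>).

  For the last claim, \<open>d i = 1\<close> makes \<open>r i\<close> the full sum over the neighbours of \<open>i\<close>. As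
  soon as \<open>i\<close> has a second neighbour, \<open>r i\<close> exceeds \<open>r j\<close> for each neighbour \<open>j\<close>
  (lemma \<open>unit_entry_exceeds_neighbour\<close>). Two adjacent vertices cannot exceed each other.
\<close>

section \<open>Arithmetical structures on arbitrary graphs\<close>

abbreviation nbrs :: "'a pair_pre_digraph \<Rightarrow> 'a \<Rightarrow> 'a set" where
  "nbrs G v \<equiv> {u. (v, u) \<in> parcs G}"

lemma
  assumes "pair_graph G"
  shows finite_pverts: "finite (pverts G)"
    and nbrs_subset: "nbrs G v \<subseteq> pverts G"
    and finite_nbrs: "finite (nbrs G v)"
    and parcs_commute: "(u, v) \<in> parcs G \<longleftrightarrow> (v, u) \<in> parcs G"
proof -
  interpret pair_graph G by fact
  show fin: "finite (pverts G)" by simp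
  show sub: "nbrs G v \<subseteq> pverts G"
    using in_arcsD2 by auto
  show "finite (nbrs G v)"
    using sub fin by (rule finite_subset)
  show "(u, v) \<in> parcs G \<longleftrightarrow> (v, u) \<in> parcs G"
    using arcs_symmetric by auto
qed

text \<open>The vector of ones is a left null vector of the Laplacian \<open>diag deg - A\<close>, because
  \<open>A\<close> is symmetric; pairing it with \<open>(diag d - A) r = 0\<close> leaves only the differences
  \<open>d v - deg v\<close>.\<close>

lemma degree_excess_balance:
  assumes G: "pair_graph G" and ar: "arithmetical_structure G d r"
  shows "(\<Sum>v\<in>pverts G. (int (d v) - int (card (nbrs G v))) * int (r v)) = 0"
proof -
  note fin = finite_pverts[OF G]
  have nb: "nbrs G v = {u \<in> pverts G. (v, u) \<in> parcs G}" for v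
    using nbrs_subset[OF G, of v] by auto
  have "(\<Sum>v\<in>pverts G. d v * r v) = (\<Sum>v\<in>pverts G. \<Sum>u\<in>{u \<in> pverts G. (v, u) \<in> parcs G}. r u)"
    using ar unfolding arithmetical_structure_def nb by simp
  also have "\<dots> = (\<Sum>u\<in>pverts G. \<Sum>v\<in>{v \<in> pverts G. (v, u) \<in> parcs G}. r u)"
    by (rule sum.swap_restrict) (use fin in auto)
  also have "\<dots> = (\<Sum>u\<in>pverts G. card (nbrs G u) * r u)"
    unfolding nb by (subst parcs_commute[OF G]) simp
  finally have "int (\<Sum>v\<in>pverts G. d v * r v) = int (\<Sum>u\<in>pverts G. card (nbrs G u) * r u)"
    by simp
  then show ?thesis
    by (simp add: left_diff_distrib sum_subtractf)
qed

text \<open>Maximum principle: at a vertex where \<open>r\<close> is maximal, the average over the neighbours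
  equals the maximum, so all neighbours attain it as well; connectedness spreads the maximum to
  every vertex.\<close>

lemma structure_of_degrees_trivial:
  assumes G: "pair_graph G" and con: "connected (with_proj G)"
    and ar: "arithmetical_structure G d r"
    and deg: "\<And>v. v \<in> pverts G \<Longrightarrow> d v = card (nbrs G v)"
    and v: "v \<in> pverts G"
  shows "r v = 1"
proof -
  interpret pair_graph G by fact
  have fin: "finite (r ` pverts G)"
    using finite_pverts[OF G] by simp
  define M where "M = Max (r ` pverts G)"
  have le: "r u \<le> M" if "u \<in> pverts G" for u
    using that fin by (simp add: M_def)
  have "M \<in> r ` pverts G"
    unfolding M_def using fin v by (intro Max_in) auto
  then obtain m where m: "m \<in> pverts G" "r m = M"
    by auto
  have spread: "r y = M" if "(x, y) \<in> parcs G" and rx: "r x = M" and x: "x \<in> pverts G" for x y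
  proof -
    have "d x * r x = (\<Sum>u\<in>nbrs G x. r u)"
      using ar x unfolding arithmetical_structure_def by blast
    then have "(\<Sum>u\<in>nbrs G x. r u) = (\<Sum>u\<in>nbrs G x. M)"
      by (simp add: rx deg[OF x])
    moreover have "r u \<le> M" if "u \<in> nbrs G x" for u
      using le that nbrs_subset[OF G, of x] by blast
    ultimately show ?thesis
      using sum_mono_inv[of r "nbrs G x" "\<lambda>_. M" y] finite_nbrs[OF G] that(1) by blast
  qed
  have const: "r u = M" if "u \<in> pverts G" for u
  proof -
    have "m \<rightarrow>\<^sup>*\<^bsub>with_proj G\<^esub> u"
      using symmetric_connected_imp_strongly_connected[OF sym_arcs con] that m(1)
      by (simp add: strongly_connected_def)
    then show ?thesis
    proof (induction rule: reachable_induct)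
      case base
      show ?case by (rule m(2))
    next
      case (step x y)
      then show ?case
        using spread[of x y] reachable_in_verts by auto
    qed
  qed
  have "r ` pverts G = {M}"
    using const v by auto
  then have "M = 1"
    using ar unfolding arithmetical_structure_def by simp
  then show ?thesis
    using const[OF v] by simp
qed

lemma unit_entry_exceeds_neighbour:
  assumes G: "pair_graph G" and ar: "arithmetical_structure G d r"
    and one: "d i = 1" and j: "j \<in> nbrs G i" and k: "k \<in> nbrs G i" "k \<noteq> j"
  shows "r j < r i"
proof -
  have i: "i \<in> pverts G"
    using j nbrs_subset[OF G, of j] parcs_commute[OF G] by auto
  have "r k > 0"
    using ar k nbrs_subset[OF G, of i] unfolding arithmetical_structure_def by auto
  then have "r j < (\<Sum>u\<in>{j, k}. r u)"
    using k by simp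
  also have "\<dots> \<le> (\<Sum>u\<in>nbrs G i. r u)"
    using j k finite_nbrs[OF G] by (intro sum_mono2) auto
  also have "\<dots> = r i"
    using ar i one unfolding arithmetical_structure_def by force
  finally show ?thesis .
qed

section \<open>Degrees in the wheel\<close>

lemma nbrs_wheel_hub: "n \<ge> 3 \<Longrightarrow> nbrs (wheel n) 0 = {1..n}"
  by (auto simp: wheel_def wheel_edges_def)

lemma nbrs_wheel_rim:
  assumes "n \<ge> 3" "i \<in> {1..n}"
  shows "nbrs (wheel n) i = {0, if i = 1 then n else i - 1, if i = n then 1 else i + 1}"
  using assms by (auto simp: wheel_def wheel_edges_def)

lemma card_nbrs_wheel_rim:
  assumes "n \<ge> 3" "i \<in> {1..n}"
  shows "card (nbrs (wheel n) i) = 3"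
  using assms by (subst nbrs_wheel_rim[OF assms]) auto

lemma card_nbrs_wheel:
  assumes "n \<ge> 3" "i \<in> {0..n}"
  shows "card (nbrs (wheel n) i) = (if i = 0 then n else 3)"
  using assms nbrs_wheel_hub card_nbrs_wheel_rim by auto

section \<open>Entries of arithmetical structures on the wheel\<close>

theorem theorem3p1:
  fixes n :: nat and d r :: "nat \<Rightarrow> nat"
  assumes "n \<ge> 3"
    and "arithmetical_structure (wheel n) d r"
  shows "(\<not> (\<forall>i \<in> {0..n}. r i = 1) \<longrightarrow>
           (d 0 > n \<and> (\<exists>i \<in> {1..n}. d i < 3)) \<or>
           (d 0 < n \<and> (\<exists>i \<in> {1..n}. d i > 3)) \<or>
           (d 0 = n \<and> (\<exists>i \<in> {1..n}. \<exists>j \<in> {1..n}. i \<noteq> j \<and> d i < 3 \<and> d j > 3))) \<and>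
         (\<forall>i \<in> {0..n}. d i = 1 \<longrightarrow>
           (\<forall>j. (i, j) \<in> parcs (wheel n) \<longrightarrow> d j > 1))"
proof (intro conjI impI ballI allI)
  note G = pair_graph_wheel[OF assms(1)]
  have pos: "d v > 0" "r v > 0" if "v \<in> {0..n}" for v
    using assms(2) that unfolding arithmetical_structure_def by auto
  let ?e = "\<lambda>i. (int (d i) - 3) * int (r i)"
  have "{0..n} = insert 0 {1..n}"
    by auto
  then have "(\<Sum>v\<in>insert 0 {1..n}. (int (d v) - int (card (nbrs (wheel n) v))) * int (r v)) = 0"
    using degree_excess_balance[OF G assms(2)] by simp
  then have "(int (d 0) - int n) * int (r 0)
      + (\<Sum>v\<in>{1..n}. (int (d v) - int (card (nbrs (wheel n) v))) * int (r v)) = 0"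
    using card_nbrs_wheel[OF assms(1), of 0] by simp
  moreover have "(\<Sum>v\<in>{1..n}. (int (d v) - int (card (nbrs (wheel n) v))) * int (r v))
      = (\<Sum>i\<in>{1..n}. ?e i)"
    by (rule sum.cong[OF refl]) (simp only: card_nbrs_wheel_rim[OF assms(1)] of_nat_numeral)
  ultimately have balance: "(int (d 0) - int n) * int (r 0) + (\<Sum>i\<in>{1..n}. ?e i) = 0"
    by simp
  have neg: "\<exists>i\<in>{1..n}. d i < 3" if "(\<Sum>i\<in>{1..n}. ?e i) < 0"
  proof (rule ccontr)
    assume "\<not> ?thesis"
    then have "(\<Sum>i\<in>{1..n}. ?e i) \<ge> 0"
      by (intro sum_nonneg mult_nonneg_nonneg) force+
    with that show False by simp
  qed
  have upper: "\<exists>i\<in>{1..n}. d i > 3" if "(\<Sum>i\<in>{1..n}. ?e i) > 0"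
  proof (rule ccontr)
    assume "\<not> ?thesis"
    then have "(\<Sum>i\<in>{1..n}. ?e i) \<le> 0"
      by (intro sum_nonpos mult_nonpos_nonneg) force+
    with that show False by simp
  qed
  show "(d 0 > n \<and> (\<exists>i \<in> {1..n}. d i < 3)) \<or>
        (d 0 < n \<and> (\<exists>i \<in> {1..n}. d i > 3)) \<or>
        (d 0 = n \<and> (\<exists>i \<in> {1..n}. \<exists>j \<in> {1..n}. i \<noteq> j \<and> d i < 3 \<and> d j > 3))"
    if nontriv: "\<not> (\<forall>i \<in> {0..n}. r i = 1)"
  proof (cases "d 0" n rule: linorder_cases)
    case less
    then have "(int (d 0) - int n) * int (r 0) < 0"
      using pos(2)[of 0] by (intro mult_neg_pos) auto
    with balance upper less show ?thesis by simp
  next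
    case greater
    then have "(int (d 0) - int n) * int (r 0) > 0"
      using pos(2)[of 0] by (intro mult_pos_pos) auto
    with balance neg greater show ?thesis by simp
  next
    case equal
    with balance have zero: "(\<Sum>i\<in>{1..n}. ?e i) = 0"
      by simp
    \<comment> \<open>A vanishing sum of terms of one weak sign has only vanishing terms, so \<open>d\<close> would be the
      degree vector.\<close>
    have absurd: False if "\<And>i. i \<in> {1..n} \<Longrightarrow> ?e i = 0"
    proof -
      have "d i = card (nbrs (wheel n) i)" if "i \<in> {0..n}" for i
        using \<open>\<And>i. i \<in> {1..n} \<Longrightarrow> ?e i = 0\<close>[of i] pos(2)[OF that] that equal
          card_nbrs_wheel[OF assms(1) that]
        by (cases "i = 0") auto
      then show False
        using structure_of_degrees_trivial[OF G connected_wheel[OF assms(1)] assms(2)] nontriv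
        by simp
    qed
    have "\<exists>i\<in>{1..n}. d i < 3"
    proof (rule ccontr)
      assume "\<not> ?thesis"
      then have "?e i \<ge> 0" if "i \<in> {1..n}" for i
        using that by (intro mult_nonneg_nonneg) force+
      then have "?e i = 0" if "i \<in> {1..n}" for i
        using zero that sum_nonneg_eq_0_iff[of "{1..n}" ?e] by blast
      then show False by (rule absurd)
    qed
    moreover have "\<exists>j\<in>{1..n}. d j > 3"
    proof (rule ccontr)
      assume "\<not> ?thesis"
      then have "?e i \<le> 0" if "i \<in> {1..n}" for i
        using that by (intro mult_nonpos_nonneg) force+
      then have "?e i = 0" if "i \<in> {1..n}" for i
        using zero that sum_nonneg_eq_0_iff[of "{1..n}" "\<lambda>i. - ?e i"]
        by (simp only: sum_negf neg_0_le_iff_le neg_equal_0_iff_equal finite_atLeastAtMost) blast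
      then show False by (rule absurd)
    qed
    ultimately show ?thesis
      using equal by force
  qed
  show "d j > 1" if "i \<in> {0..n}" "d i = 1" and arc: "(i, j) \<in> parcs (wheel n)" for i j
  proof (rule ccontr)
    have j: "j \<in> {0..n}"
      using arc nbrs_subset[OF G, of i] by auto
    assume "\<not> d j > 1"
    then have "d j = 1"
      using pos(1)[OF j] by simp
    have exceeds: "r y < r x" if "x \<in> {0..n}" "d x = 1" "y \<in> nbrs (wheel n) x" for x y
    proof -
      have "card (nbrs (wheel n) x) \<ge> 2"
        using card_nbrs_wheel[OF assms(1) that(1)] assms(1) by simp
      then have "\<not> nbrs (wheel n) x \<subseteq> {y}"
        using card_mono[of "{y}" "nbrs (wheel n) x"] by auto
      then obtain k where "k \<in> nbrs (wheel n) x" "k \<noteq> y"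
        by blast
      then show ?thesis
        using unit_entry_exceeds_neighbour[where G = "wheel n", OF G assms(2)] that by blast
    qed
    have "r j < r i"
      using exceeds that by simp
    moreover have "r i < r j"
      using exceeds[OF j \<open>d j = 1\<close>, of i] arc parcs_commute[OF G, of i j] by simp
    ultimately show False by simp
  qed
qed

end
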